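(* Let $G=(V,E)$ be a finite graph and let $\theta:\mathbb{Z}_2\to\mathrm{Aut}(G)$ act freely on $V$. Let $X$ be a (possibly empty) subset of $V$. Then the following are equivalent: (a) $G$ can be realised as a $\mathbb{Z}_2$-symmetric (resp. forced $\mathbb{Z}_2$-symmetric) infinitesimally rigid bar-joint framework on $\mathbb{S}^2$ with respect to $\theta$ and $\tau:\mathbb{Z}_2\to\mathcal{C}_s$, where the points assigned to $X$ lie on a great circle. (b) $G$ can be realised as a $\mathbb{Z}_2$-symmetric (resp. forced $\mathbb{Z}_2$-symmetric) infinitesimally rigid bar-joint framework on $\mathbb{S}^2$ with respect to $\theta$ and $\tau':\mathbb{Z}_2\to\mathcal{C}_2$, where the points assigned to $X$ lie on a great circle.
   Context: $\mathcal{C}_s\subset O(\mathbb{R}^3)$ is the group generated by a reflection in a plane through the origin; $\mathcal{C}_2$ is the group generated by a half-turn about a line through the origin; $\tau,\tau'$ are isomorphisms onto these groups. Write $\gamma i=\theta(\gamma)(i)$. A spherical (bar-joint) framework $(G,q)$ on $\mathbb{S}^2$: $q:V\to\mathbb{S}^2$ with image spanning $\mathbb{R}^3$. Infinitesimal motions: $\dot q:V\to\mathbb{R}^3$ with $\langle q_i,\dot q_j\rangle+\langle q_j,\dot q_i\rangle=0$ for $\{i,j\}\in E$ and $\langle q_i,\dot q_i\rangle=0$ for $i\in V$; trivial motions are $\dot q_i=Sq_i$ with $S$ skew-symmetric; infinitesimally rigid means every motion is trivial (motion space of dimension 3). $(G,q)$ is $\mathbb{Z}_2$-symmetric w.r.t.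 $\theta,\tau$ if $\tau(\gamma)q(i)=q(\gamma i)$ for all $\gamma,i$; a motion is $\mathbb{Z}_2$-symmetric if $\tau(\gamma)\dot q_i=\dot q_{\gamma i}$; forced $\mathbb{Z}_2$-symmetric infinitesimally rigid means every $\mathbb{Z}_2$-symmetric infinitesimal motion is trivial. "Infinitesimally rigid $\mathbb{Z}_2$-symmetric framework" means a $\mathbb{Z}_2$-symmetric framework which is infinitesimally rigid. *)

theory Defs
  imports
    "HOL-Analysis.Analysis"
    "HOL-Algebra.Bij"
    "HOL-Algebra.Generated_Groups"
    "HOL-Algebra.Elementary_Groups"
begin

definition finite_graph :: "'a set \<Rightarrow> 'a set set \<Rightarrow> bool" where
  "finite_graph V E \<longleftrightarrow> finite V \<and> (\<forall>e\<in>E. \<exists>i\<in>V. \<exists>j\<in>V. i \<noteq> j \<and> e = {i, j})"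

definition graph_Aut :: "'a set \<Rightarrow> 'a set set \<Rightarrow> ('a \<Rightarrow> 'a) monoid" where
  "graph_Aut V E = BijGroup V
     \<lparr>carrier := {f \<in> Bij V. \<forall>i\<in>V. \<forall>j\<in>V. {f i, f j} \<in> E \<longleftrightarrow> {i, j} \<in> E}\<rparr>"

abbreviation Z2 :: "int monoid" where
  "Z2 \<equiv> integer_mod_group 2"

definition acts_freely :: "'a set \<Rightarrow> (int \<Rightarrow> 'a \<Rightarrow> 'a) \<Rightarrow> bool" where
  "acts_freely V \<theta> \<longleftrightarrow> (\<forall>\<gamma>\<in>carrier Z2. \<forall>i\<in>V. \<theta> \<gamma> i = i \<longrightarrow> \<gamma> = \<one>\<^bsub>Z2\<^esub>)"

definition orthogonal_group3 :: "(real^3 \<Rightarrow> real^3) monoid" where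
  "orthogonal_group3 = \<lparr>carrier = {f. orthogonal_transformation f}, mult = (\<circ>), one = id\<rparr>"

definition plane_reflection :: "(real^3 \<Rightarrow> real^3) \<Rightarrow> bool" where
  "plane_reflection s \<longleftrightarrow> linear s \<and>
     (\<exists>P. subspace P \<and> dim P = 2 \<and> (\<forall>x\<in>P. s x = x) \<and> (\<forall>x\<in>orthogonal_comp P. s x = - x))"

text \<open>The rotation through the angle \<open>\<pi>\<close> about a line \<open>L\<close> fixes \<open>L\<close> pointwise and acts as \<open>-1\<close> on
  the plane perpendicular to \<open>L\<close>.\<close>

definition half_turn :: "(real^3 \<Rightarrow> real^3) \<Rightarrow> bool" where
  "half_turn h \<longleftrightarrow> linear h \<and>
     (\<exists>L. subspace L \<and> dim L = 1 \<and> (\<forall>x\<in>L. h x = x) \<and> (\<forall>x\<in>orthogonal_comp L. h x = - x))"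

text \<open>For a plane reflection \<open>g\<close> this is a group \<open>C\<^sub>s\<close>, for a half-turn \<open>g\<close> it is a group \<open>C\<^sub>2\<close>.\<close>

definition point_group :: "(real^3 \<Rightarrow> real^3) \<Rightarrow> (real^3 \<Rightarrow> real^3) monoid" where
  "point_group g = orthogonal_group3 \<lparr>carrier := generate orthogonal_group3 {g}\<rparr>"

text \<open>Placements and velocities are functions on the whole vertex type; only their values on \<open>V\<close>
  matter.\<close>

definition spherical_framework :: "'a set \<Rightarrow> ('a \<Rightarrow> real^3) \<Rightarrow> bool" where
  "spherical_framework V q \<longleftrightarrow> (\<forall>i\<in>V. q i \<in> sphere 0 1) \<and> span (q ` V) = UNIV"

definition infinitesimal_motion ::
  "'a set \<Rightarrow> 'a set set \<Rightarrow> ('a \<Rightarrow> real^3) \<Rightarrow> ('a \<Rightarrow> real^3) \<Rightarrow> bool" where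
  "infinitesimal_motion V E q m \<longleftrightarrow>
     (\<forall>i\<in>V. \<forall>j\<in>V. {i, j} \<in> E \<longrightarrow> q i \<bullet> m j + q j \<bullet> m i = 0) \<and>
     (\<forall>i\<in>V. q i \<bullet> m i = 0)"

definition trivial_motion :: "'a set \<Rightarrow> ('a \<Rightarrow> real^3) \<Rightarrow> ('a \<Rightarrow> real^3) \<Rightarrow> bool" where
  "trivial_motion V q m \<longleftrightarrow> (\<exists>S :: real^3^3. transpose S = - S \<and> (\<forall>i\<in>V. m i = S *v q i))"

definition infinitesimally_rigid :: "'a set \<Rightarrow> 'a set set \<Rightarrow> ('a \<Rightarrow> real^3) \<Rightarrow> bool" where
  "infinitesimally_rigid V E q \<longleftrightarrow>
     (\<forall>m. infinitesimal_motion V E q m \<longrightarrow> trivial_motion V q m)"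

text \<open>Used both for placements and for velocities.\<close>

definition Z2_symmetric ::
  "'a set \<Rightarrow> (int \<Rightarrow> 'a \<Rightarrow> 'a) \<Rightarrow> (int \<Rightarrow> real^3 \<Rightarrow> real^3) \<Rightarrow> ('a \<Rightarrow> real^3) \<Rightarrow> bool" where
  "Z2_symmetric V \<theta> \<tau> p \<longleftrightarrow> (\<forall>\<gamma>\<in>carrier Z2. \<forall>i\<in>V. \<tau> \<gamma> (p i) = p (\<theta> \<gamma> i))"

definition forced_infinitesimally_rigid ::
  "'a set \<Rightarrow> 'a set set \<Rightarrow> (int \<Rightarrow> 'a \<Rightarrow> 'a) \<Rightarrow> (int \<Rightarrow> real^3 \<Rightarrow> real^3) \<Rightarrow> ('a \<Rightarrow> real^3) \<Rightarrow> bool"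
  where
  "forced_infinitesimally_rigid V E \<theta> \<tau> q \<longleftrightarrow>
     (\<forall>m. infinitesimal_motion V E q m \<and> Z2_symmetric V \<theta> \<tau> m \<longrightarrow> trivial_motion V q m)"

definition great_circle :: "(real^3) set \<Rightarrow> bool" where
  "great_circle C \<longleftrightarrow> (\<exists>P. subspace P \<and> dim P = 2 \<and> C = P \<inter> sphere 0 1)"

end

theory Submission
  imports Defs
begin

text \<open>
  The half-turn about the normal of a mirror plane is the negative of the reflection in that plane.
  Negating one point in each vertex orbit (partial inversion) therefore turns a \<open>C\<^sub>s\<close>-symmetric
  framework into a \<open>C\<^sub>2\<close>-symmetric one and conversely. If the velocities are negated at the same
  vertices, all rigidity constraints, trivial motions and great circles are preserved. When
  mirror and axis are in general position, an orthogonal matrix moving the normal of the mirror to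
  the axis is applied as well.
\<close>

section \<open>Signed orthogonal images of placements and velocities\<close>

definition signed_image ::
  "('a \<Rightarrow> real) \<Rightarrow> real^3^3 \<Rightarrow> ('a \<Rightarrow> real^3) \<Rightarrow> 'a \<Rightarrow> real^3" where
  "signed_image \<sigma> Q p = (\<lambda>i. \<sigma> i *\<^sub>R (Q *v p i))"

lemma sign_mult_self:
  assumes "range \<sigma> \<subseteq> {1, - 1 :: real}"
  shows "\<sigma> i * \<sigma> i = 1"
  using range_subsetD[OF assms, of i] by auto

text \<open>Each sign is its own inverse, so the inverse operation keeps \<open>\<sigma>\<close> and
  only transposes \<open>Q\<close>. This allows motions of the image to be pulled back.\<close>

lemma signed_image_transpose:
  assumes "orthogonal_matrix Q" and "range \<sigma> \<subseteq> {1, - 1}"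
  shows "signed_image \<sigma> (transpose Q) (signed_image \<sigma> Q p) = p"
    and "signed_image \<sigma> Q (signed_image \<sigma> (transpose Q) p) = p"
  using assms(1)
  by (simp_all add: signed_image_def fun_eq_iff matrix_vector_mult_scaleR
      matrix_vector_mul_assoc sign_mult_self[OF assms(2)] orthogonal_matrix_def
      del: transpose_matrix_vector)

lemma inner_orthogonal_matrix:
  fixes Q :: "real^'n^'n"
  assumes "orthogonal_matrix Q"
  shows "(Q *v x) \<bullet> (Q *v y) = x \<bullet> y"
  using assms
  by (metis orthogonal_transformation_def orthogonal_transformation_matrix
      matrix_of_matrix_vector_mul matrix_vector_mul_linear)

lemma inner_signed_image:
  assumes "orthogonal_matrix Q"
  shows "signed_image \<sigma> Q p i \<bullet> signed_image \<sigma> Q r j = \<sigma> i * \<sigma> j * (p i \<bullet> r j)"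
  by (simp add: signed_image_def inner_orthogonal_matrix[OF assms])

text \<open>Placement and velocity carry the same sign at a vertex, so both summands of an edge
  constraint pick up the common factor \<open>\<sigma> i * \<sigma> j\<close> and the sum still
  vanishes.\<close>

lemma infinitesimal_motion_signed_image:
  assumes Q: "orthogonal_matrix Q" and m: "infinitesimal_motion V E q m"
  shows "infinitesimal_motion V E (signed_image \<sigma> Q q) (signed_image \<sigma> Q m)"
proof -
  have "\<sigma> i * \<sigma> j * (q i \<bullet> m j) + \<sigma> j * \<sigma> i * (q j \<bullet> m i)
      = \<sigma> i * \<sigma> j * (q i \<bullet> m j + q j \<bullet> m i)" for i j
    by (simp add: algebra_simps)
  with m show ?thesis
    by (simp add: infinitesimal_motion_def inner_signed_image[OF Q])
qed

text \<open>Conjugating \<open>S\<close> by \<open>Q\<close> keeps it skew-symmetric, and scalar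
  signs commute with matrices, so one conjugated matrix serves all vertices whatever their
  signs.\<close>

lemma trivial_motion_signed_image:
  assumes Q: "orthogonal_matrix Q" and "trivial_motion V q m"
  shows "trivial_motion V (signed_image \<sigma> Q q) (signed_image \<sigma> Q m)"
proof -
  obtain S where S: "transpose S = - S" "\<And>i. i \<in> V \<Longrightarrow> m i = S *v q i"
    using assms(2) by (auto simp: trivial_motion_def)
  let ?S = "Q ** S ** transpose Q"
  have "Q ** (- S) ** transpose Q = - ?S"
    by (simp add: matrix_matrix_mult_def vec_eq_iff sum_negf)
  then have "transpose ?S = - ?S"
    by (simp add: matrix_transpose_mul S(1) matrix_mul_assoc)
  moreover have "signed_image \<sigma> Q m i = ?S *v signed_image \<sigma> Q q i" if "i \<in> V" for i
  proof -
    have "?S ** Q = Q ** S"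
      using Q by (metis matrix_mul_assoc matrix_mul_rid orthogonal_matrix_def)
    then show ?thesis
      using S(2)[OF that]
      by (simp add: signed_image_def matrix_vector_mult_scaleR matrix_vector_mul_assoc)
  qed
  ultimately show ?thesis
    unfolding trivial_motion_def by blast
qed

text \<open>A second factor \<open>\<sigma> i\<close> cancels the first, so the new span contains
  every \<open>Q *v q i\<close>; these already span because \<open>Q\<close> is surjective.\<close>

lemma spherical_framework_signed_image:
  assumes Q: "orthogonal_matrix Q" and \<sigma>: "range \<sigma> \<subseteq> {1, - 1}"
    and q: "spherical_framework V q"
  shows "spherical_framework V (signed_image \<sigma> Q q)"
proof -
  let ?U = "span (signed_image \<sigma> Q q ` V)"
  have "surj ((*v) Q)"
    using Q by (metis matrix_right_invertible_surjective orthogonal_matrix_def)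
  have "Q *v q i \<in> ?U" if "i \<in> V" for i
  proof -
    have "\<sigma> i *\<^sub>R signed_image \<sigma> Q q i \<in> ?U"
      using that by (intro span_mul span_base) auto
    then show ?thesis
      by (simp add: signed_image_def sign_mult_self[OF \<sigma>])
  qed
  then have "span ((*v) Q ` q ` V) \<subseteq> ?U"
    by (intro span_minimal) auto
  moreover have "span ((*v) Q ` q ` V) = UNIV"
    using q \<open>surj ((*v) Q)\<close>
    by (simp add: linear_span_image matrix_vector_mul_linear spherical_framework_def)
  ultimately have "?U = UNIV"
    by auto
  moreover have "norm (signed_image \<sigma> Q q i) = 1" if "i \<in> V" for i
    using q that
    by (simp add: spherical_framework_def norm_eq_1 inner_signed_image[OF Q] sign_mult_self[OF \<sigma>])
  ultimately show ?thesis
    by (simp add: spherical_framework_def)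
qed

text \<open>A plane through the origin is closed under negation, so the image plane
  \<open>Q P\<close> contains the new points for either choice of sign.\<close>

lemma great_circle_signed_image:
  assumes Q: "orthogonal_matrix Q" and \<sigma>: "range \<sigma> \<subseteq> {1, - 1}"
    and C: "great_circle C" "q ` X \<subseteq> C"
  shows "\<exists>C'. great_circle C' \<and> signed_image \<sigma> Q q ` X \<subseteq> C'"
proof -
  obtain P where P: "subspace P" "dim P = 2" "C = P \<inter> sphere 0 1"
    using C(1) by (auto simp: great_circle_def)
  let ?P = "(*v) Q ` P"
  have "inj ((*v) Q)"
    using Q by (metis matrix_left_invertible_injective orthogonal_matrix_def)
  then have "dim ?P = 2"
    using P(2) by (simp add: dim_image_eq matrix_vector_mul_linear inj_on_subset[of _ UNIV])
  moreover have sub: "subspace ?P"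
    by (simp add: P(1) linear_subspace_image matrix_vector_mul_linear)
  ultimately have "great_circle (?P \<inter> sphere 0 1)"
    unfolding great_circle_def by blast
  moreover have "signed_image \<sigma> Q q i \<in> ?P \<inter> sphere 0 1" if "i \<in> X" for i
  proof -
    have "q i \<in> P" "norm (q i) = 1"
      using that C(2) P(3) by auto
    then show ?thesis
      using subspace_scale[OF sub, of "Q *v q i" "\<sigma> i"]
      by (simp add: norm_eq_1 inner_signed_image[OF Q] sign_mult_self[OF \<sigma>])
        (simp add: signed_image_def)
  qed
  ultimately show ?thesis
    by (metis image_subsetI)
qed

section \<open>Transfer of symmetry and rigidity\<close>

lemma Z2_symmetric_signed_image:
  assumes "\<And>\<gamma> i x. \<gamma> \<in> carrier Z2 \<Longrightarrow> i \<in> V \<Longrightarrow>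
      \<tau>' \<gamma> (\<sigma> i *\<^sub>R (Q *v x)) = \<sigma> (\<theta> \<gamma> i) *\<^sub>R (Q *v \<tau> \<gamma> x)"
    and "Z2_symmetric V \<theta> \<tau> p"
  shows "Z2_symmetric V \<theta> \<tau>' (signed_image \<sigma> Q p)"
  using assms by (simp add: Z2_symmetric_def signed_image_def)

text \<open>The intertwining relation for a single group element, with \<open>j\<close> in the role
  of \<open>\<theta> \<gamma> i\<close>, can be inverted. The inverse form serves to pull back
  symmetric velocities and to exchange the roles of the two groups.\<close>

lemma intertwining_transpose:
  fixes Q :: "real^'n^'n"
  assumes Q: "orthogonal_matrix Q" and \<sigma>: "range \<sigma> \<subseteq> {1, - 1}"
    and eq: "\<And>x. f' (\<sigma> i *\<^sub>R (Q *v x)) = \<sigma> j *\<^sub>R (Q *v f x)"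
  shows "f (\<sigma> i *\<^sub>R (transpose Q *v y)) = \<sigma> j *\<^sub>R (transpose Q *v f' y)"
proof -
  \<comment> \<open>The argument is chosen so that signs and matrices cancel inside
    \<open>f'\<close>, leaving \<open>y\<close>.\<close>
  have "f' y = \<sigma> j *\<^sub>R (Q *v f (\<sigma> i *\<^sub>R (transpose Q *v y)))"
    using eq[of "\<sigma> i *\<^sub>R (transpose Q *v y)"] Q
    by (simp add: matrix_vector_mult_scaleR matrix_vector_mul_assoc sign_mult_self[OF \<sigma>]
        orthogonal_matrix_def del: transpose_matrix_vector)
  then show ?thesis
    using Q by (simp add: matrix_vector_mult_scaleR matrix_vector_mul_assoc sign_mult_self[OF \<sigma>]
        orthogonal_matrix_def del: transpose_matrix_vector)
qed

text \<open>A motion of the image pulls back along \<open>transpose Q\<close> to a motion of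
  \<open>q\<close>, which is trivial; pushing it forward again returns the original motion and keeps
  it trivial.\<close>

lemma rigid_signed_image:
  assumes Q: "orthogonal_matrix Q" and \<sigma>: "range \<sigma> \<subseteq> {1, - 1}"
    and q: "infinitesimally_rigid V E q"
  shows "infinitesimally_rigid V E (signed_image \<sigma> Q q)"
  using q unfolding infinitesimally_rigid_def
  by (metis Q infinitesimal_motion_signed_image orthogonal_matrix_transpose
      signed_image_transpose[OF Q \<sigma>] trivial_motion_signed_image)

lemma forced_rigid_signed_image:
  assumes Q: "orthogonal_matrix Q" and \<sigma>: "range \<sigma> \<subseteq> {1, - 1}"
    and eq: "\<And>\<gamma> i x. \<gamma> \<in> carrier Z2 \<Longrightarrow> i \<in> V \<Longrightarrow>
      \<tau>' \<gamma> (\<sigma> i *\<^sub>R (Q *v x)) = \<sigma> (\<theta> \<gamma> i) *\<^sub>R (Q *v \<tau> \<gamma> x)"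
    and q: "forced_infinitesimally_rigid V E \<theta> \<tau> q"
  shows "forced_infinitesimally_rigid V E \<theta> \<tau>' (signed_image \<sigma> Q q)"
  unfolding forced_infinitesimally_rigid_def
proof (intro allI impI, elim conjE)
  fix m
  assume m: "infinitesimal_motion V E (signed_image \<sigma> Q q) m" "Z2_symmetric V \<theta> \<tau>' m"
  let ?m = "signed_image \<sigma> (transpose Q) m"
  have "infinitesimal_motion V E q ?m"
    using infinitesimal_motion_signed_image[OF _ m(1), of "transpose Q" \<sigma>]
    by (simp add: Q signed_image_transpose[OF Q \<sigma>])
  \<comment> \<open>Beyond the plain rigid case, the pulled-back velocity must be symmetric for
    \<open>\<tau>\<close>; this is the inverted intertwining relation.\<close>
  moreover have "Z2_symmetric V \<theta> \<tau> ?m"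
    by (rule Z2_symmetric_signed_image[OF _ m(2)]) 
      (rule intertwining_transpose[where f = "\<tau> _" and f' = "\<tau>' _", OF Q \<sigma> eq])
  ultimately have "trivial_motion V q ?m"
    using q by (simp add: forced_infinitesimally_rigid_def)
  then show "trivial_motion V (signed_image \<sigma> Q q) m"
    using trivial_motion_signed_image[OF Q, of V q ?m \<sigma>]
    by (simp add: signed_image_transpose[OF Q \<sigma>])
qed

text \<open>Only one direction is stated, for arbitrary \<open>\<tau>\<close> and
  \<open>\<tau>'\<close>; the converse arises by swapping them and using
  \<open>transpose Q\<close>.\<close>

lemma realisation_signed_image:
  assumes Q: "orthogonal_matrix Q" and \<sigma>: "range \<sigma> \<subseteq> {1, - 1}"
    and eq: "\<And>\<gamma> i x. \<gamma> \<in> carrier Z2 \<Longrightarrow> i \<in> V \<Longrightarrow>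
      \<tau>' \<gamma> (\<sigma> i *\<^sub>R (Q *v x)) = \<sigma> (\<theta> \<gamma> i) *\<^sub>R (Q *v \<tau> \<gamma> x)"
  shows "(\<exists>q. spherical_framework V q \<and> Z2_symmetric V \<theta> \<tau> q \<and>
           infinitesimally_rigid V E q \<and> (\<exists>C. great_circle C \<and> q ` X \<subseteq> C)) \<Longrightarrow>
         (\<exists>q. spherical_framework V q \<and> Z2_symmetric V \<theta> \<tau>' q \<and>
           infinitesimally_rigid V E q \<and> (\<exists>C. great_circle C \<and> q ` X \<subseteq> C))"
    and "(\<exists>q. spherical_framework V q \<and> Z2_symmetric V \<theta> \<tau> q \<and>
           forced_infinitesimally_rigid V E \<theta> \<tau> q \<and> (\<exists>C. great_circle C \<and> q ` X \<subseteq> C)) \<Longrightarrow>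
         (\<exists>q. spherical_framework V q \<and> Z2_symmetric V \<theta> \<tau>' q \<and>
           forced_infinitesimally_rigid V E \<theta> \<tau>' q \<and> (\<exists>C. great_circle C \<and> q ` X \<subseteq> C))"
proof -
  note sph = spherical_framework_signed_image[OF Q \<sigma>]
    and sym = Z2_symmetric_signed_image[where \<tau>' = \<tau>' and \<tau> = \<tau>, OF eq]
    and circ = great_circle_signed_image[OF Q \<sigma>]
    and rig = rigid_signed_image[OF Q \<sigma>]
    and frig = forced_rigid_signed_image[where \<tau>' = \<tau>' and \<tau> = \<tau>, OF Q \<sigma> eq]
  show "\<exists>q. spherical_framework V q \<and> Z2_symmetric V \<theta> \<tau>' q \<and>
      infinitesimally_rigid V E q \<and> (\<exists>C. great_circle C \<and> q ` X \<subseteq> C)"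
    if "\<exists>q. spherical_framework V q \<and> Z2_symmetric V \<theta> \<tau> q \<and>
      infinitesimally_rigid V E q \<and> (\<exists>C. great_circle C \<and> q ` X \<subseteq> C)"
    using that by (elim exE conjE) (intro exI[of _ "signed_image \<sigma> Q _"] conjI sph sym rig circ)
  show "\<exists>q. spherical_framework V q \<and> Z2_symmetric V \<theta> \<tau>' q \<and>
      forced_infinitesimally_rigid V E \<theta> \<tau>' q \<and> (\<exists>C. great_circle C \<and> q ` X \<subseteq> C)"
    if "\<exists>q. spherical_framework V q \<and> Z2_symmetric V \<theta> \<tau> q \<and>
      forced_infinitesimally_rigid V E \<theta> \<tau> q \<and> (\<exists>C. great_circle C \<and> q ` X \<subseteq> C)"
    using that by (elim exE conjE) (intro exI[of _ "signed_image \<sigma> Q _"] conjI sph sym frig circ)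
qed

section \<open>Normal forms of plane reflections and half-turns\<close>

lemma plane_reflection_formula:
  assumes "plane_reflection s"
  obtains n where "norm n = 1" "\<And>x. s x = x - (2 * (n \<bullet> x)) *\<^sub>R n"
proof -
  obtain P where lin: "linear s" and P: "subspace P" "dim P = 2" "\<And>x. x \<in> P \<Longrightarrow> s x = x"
    "\<And>x. x \<in> orthogonal_comp P \<Longrightarrow> s x = - x"
    using assms by (auto simp: plane_reflection_def)
  obtain y where y: "y \<noteq> 0" "\<And>x. x \<in> span P \<Longrightarrow> orthogonal y x"
    using orthogonal_to_subspace_exists[of P] P(2) by auto
  define n where "n = y /\<^sub>R norm y"
  have n: "norm n = 1"
    using y(1) by (simp add: n_def)
  have orth: "n \<bullet> x = 0" if "x \<in> P" for x
    using y(2)[OF span_base[OF that]] by (simp add: n_def orthogonal_def)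
  \<comment> \<open>\<open>P\<close> lies in this hyperplane and both have dimension 2.\<close>
  have "P = {x. n \<bullet> x = 0}"
  proof (rule subspace_dim_equal)
    have "n \<noteq> 0"
      using n by auto
    then show "dim {x. n \<bullet> x = 0} \<le> dim P"
      by (simp add: dim_hyperplane P(2))
  qed (use P(1) orth in \<open>auto simp: subspace_hyperplane\<close>)
  \<comment> \<open>Each \<open>x\<close> splits into a part in \<open>P\<close>, fixed by
    \<open>s\<close>, and a multiple of \<open>n\<close>, which \<open>s\<close> negates.\<close>
  then have "x - (n \<bullet> x) *\<^sub>R n \<in> P" for x
    using n by (simp add: inner_diff_right norm_eq_1)
  from P(3)[OF this] have "s x - (n \<bullet> x) *\<^sub>R s n = x - (n \<bullet> x) *\<^sub>R n" for x
    by (simp add: linear_diff[OF lin] linear_scale[OF lin])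
  moreover have "s n = - n"
    using orth by (intro P(4)) (auto simp: orthogonal_comp_def orthogonal_def inner_commute)
  ultimately have "s x = x - (n \<bullet> x) *\<^sub>R n - (n \<bullet> x) *\<^sub>R n" for x
    by (simp add: eq_diff_eq add.commute)
  then have "s x = x - (2 * (n \<bullet> x)) *\<^sub>R n" for x
    by (simp only: mult_2 scaleR_left_distrib diff_diff_eq)
  with n show ?thesis
    by (rule that)
qed

lemma half_turn_formula:
  assumes "half_turn h"
  obtains l where "norm l = 1" "\<And>x. h x = (2 * (l \<bullet> x)) *\<^sub>R l - x"
proof -
  obtain L where lin: "linear h" and L: "subspace L" "dim L = 1" "\<And>x. x \<in> L \<Longrightarrow> h x = x"
    "\<And>x. x \<in> orthogonal_comp L \<Longrightarrow> h x = - x"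
    using assms by (auto simp: half_turn_def)
  have "\<not> L \<subseteq> {0}"
    using L(2) by (metis dim_eq_0 zero_neq_one)
  then obtain y where y: "y \<in> L" "y \<noteq> 0"
    by auto
  define l where "l = y /\<^sub>R norm y"
  have l: "norm l = 1" "l \<in> L"
    using y L(1) by (auto simp: l_def subspace_scale)
  have "span {l} = L"
  proof (rule subspace_dim_equal)
    have "l \<noteq> 0"
      using l by auto
    then show "dim L \<le> dim (span {l})"
      by (simp add: L(2))
  qed (use L(1) l in \<open>auto intro: span_minimal[THEN subsetD]\<close>)
  \<comment> \<open>Dual splitting: the component along \<open>l\<close> is fixed by
    \<open>h\<close>, and the remainder, orthogonal to \<open>L\<close>, is negated.\<close>
  then have "x - (l \<bullet> x) *\<^sub>R l \<in> orthogonal_comp L" for x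
    using l(1) by (auto simp: orthogonal_comp_def orthogonal_def span_singleton
        inner_diff_right inner_diff_left norm_eq_1 inner_commute)
  then have "h x - (l \<bullet> x) *\<^sub>R h l = - (x - (l \<bullet> x) *\<^sub>R l)" for x
    using L(4) by (metis lin linear_diff linear_scale)
  then have "h x = (2 * (l \<bullet> x)) *\<^sub>R l - x" for x
    using L(3)[OF l(2)] by (simp add: algebra_simps scaleR_2 flip: scaleR_scaleR)
  with l(1) show ?thesis
    by (rule that)
qed

section \<open>The two-element groups, the action on vertices and alternating signs\<close>

lemma negating_not_id:
  fixes x :: "'b::real_vector"
  assumes "f x = - x" "x \<noteq> 0"
  shows "f \<noteq> id"
proof
  assume "f = id"
  then have "2 *\<^sub>R x = 0"
    using assms(1) by (simp add: scaleR_2 eq_neg_iff_add_eq_0)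
  with assms(2) show False
    by simp
qed

lemma carrier_Z2: "carrier Z2 = {0, 1}"
  by (auto simp: carrier_integer_mod_group)

lemma iso_Z2_point_group:
  assumes \<tau>: "\<tau> \<in> iso Z2 (point_group g)" and g: "g \<circ> g = id" "g \<noteq> id"
  shows "\<tau> 0 = id" "\<tau> 1 = g"
proof -
  have "id \<in> carrier (point_group g)" "g \<in> carrier (point_group g)"
    using generate.one[of orthogonal_group3 "{g}"] generate.incl[of g "{g}" orthogonal_group3]
    by (simp_all add: point_group_def orthogonal_group3_def)
  moreover have "\<tau> ` carrier Z2 = carrier (point_group g)"
    using \<tau> by (auto simp: iso_def bij_betw_def)
  ultimately have "id \<in> {\<tau> 0, \<tau> 1}" "g \<in> {\<tau> 0, \<tau> 1}"
    by (auto simp: carrier_Z2)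
  moreover have "\<tau> 0 = \<tau> 0 \<circ> \<tau> 0"
  proof -
    have "\<tau> (0 \<otimes>\<^bsub>Z2\<^esub> 0) = \<tau> 0 \<otimes>\<^bsub>point_group g\<^esub> \<tau> 0"
      using \<tau> by (intro hom_mult[of \<tau>]) (auto simp: iso_def carrier_Z2)
    then show ?thesis
      by (simp add: point_group_def orthogonal_group3_def mult_integer_mod_group)
  qed
  \<comment> \<open>The two values are \<open>id\<close> and \<open>g\<close> in some order. The
    idempotent \<open>\<tau> 0\<close> cannot be \<open>g\<close>, because
    \<open>g \<circ> g = id\<close> differs from \<open>g\<close>.\<close>
  ultimately show "\<tau> 0 = id" "\<tau> 1 = g"
    using g by auto
qed

lemma hom_Z2_graph_Aut:
  assumes \<theta>: "\<theta> \<in> hom Z2 (graph_Aut V E)" and "i \<in> V"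
  shows "\<theta> 0 i = i" "\<theta> 1 i \<in> V" "\<theta> 1 (\<theta> 1 i) = i"
proof -
  have Bij: "\<theta> \<gamma> \<in> Bij V" if "\<gamma> \<in> {0, 1}" for \<gamma>
    using \<theta> that by (auto simp: hom_def graph_Aut_def carrier_Z2)
  \<comment> \<open>Products in \<open>BijGroup V\<close> are composed by \<open>compose\<close>,
    which restricts to \<open>V\<close>; hence the pointwise law for
    \<open>j \<in> V\<close>.\<close>
  have mult: "\<theta> ((a + b) mod 2) j = \<theta> a (\<theta> b j)" if "a \<in> {0, 1}" "b \<in> {0, 1}" "j \<in> V" for a b j
  proof -
    have "\<theta> (a \<otimes>\<^bsub>Z2\<^esub> b) = \<theta> a \<otimes>\<^bsub>graph_Aut V E\<^esub> \<theta> b"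
      using that by (intro hom_mult[OF \<theta>]) (auto simp: carrier_Z2)
    then show ?thesis
      using that Bij by (simp add: graph_Aut_def BijGroup_def mult_integer_mod_group compose_def)
  qed
  have bij: "bij_betw (\<theta> \<gamma>) V V" if "\<gamma> \<in> {0, 1}" for \<gamma>
    using Bij[OF that] by (simp add: Bij_def)
  have mem: "\<theta> \<gamma> i \<in> V" if "\<gamma> \<in> {0, 1}" for \<gamma>
    using bij[OF that] \<open>i \<in> V\<close> by (auto simp: bij_betw_def)
  show "\<theta> 1 i \<in> V"
    using mem by simp
  have "\<theta> 0 (\<theta> 0 i) = \<theta> 0 i"
    using mult[of 0 0 i] \<open>i \<in> V\<close> by simp
  \<comment> \<open>An injective idempotent map is the identity.\<close>
  then show "\<theta> 0 i = i"
    using bij[of 0] mem[of 0] \<open>i \<in> V\<close> by (auto simp: bij_betw_def dest: inj_onD)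
  then show "\<theta> 1 (\<theta> 1 i) = i"
    using mult[of 1 1 i] \<open>i \<in> V\<close> by simp
qed

text \<open>On \<open>V\<close> the orbits of the involution \<open>f\<close> are two-element sets;
  a chosen representative gets sign 1 and its partner sign -1.\<close>

lemma alternating_sign_exists:
  assumes "\<And>i. i \<in> V \<Longrightarrow> f (f i) = i" "\<And>i. i \<in> V \<Longrightarrow> f i \<noteq> i"
  obtains \<sigma> :: "'a \<Rightarrow> real"
  where "range \<sigma> \<subseteq> {1, - 1}" "\<And>i. i \<in> V \<Longrightarrow> \<sigma> (f i) = - \<sigma> i"
proof -
  \<comment> \<open>The choice depends only on the unordered pair, so \<open>i\<close> and
    \<open>f i\<close> get the same representative.\<close>
  define r where "r i = (SOME x. x \<in> {i, f i})" for i
  have r_in: "r i \<in> {i, f i}" for i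
    unfolding r_def by (rule someI[of _ i]) simp
  have r_f: "r (f i) = r i" if "i \<in> V" for i
    using assms(1)[OF that] by (simp add: r_def insert_commute)
  show ?thesis
  proof (rule that[of "\<lambda>i. if r i = i then 1 else - 1"])
    show "(if r (f i) = f i then 1 else - 1) = - (if r i = i then 1 else - 1 :: real)"
      if "i \<in> V" for i
      using r_in[of i] r_f[OF that] assms(2)[OF that] by auto
  qed auto
qed

theorem theorem5p1:
  fixes V X :: "'a set" and E :: "'a set set"
    and \<theta> :: "int \<Rightarrow> 'a \<Rightarrow> 'a"
    and s h :: "real^3 \<Rightarrow> real^3"
    and \<tau> \<tau>' :: "int \<Rightarrow> real^3 \<Rightarrow> real^3"
  assumes "finite_graph V E"
    and "\<theta> \<in> hom Z2 (graph_Aut V E)"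
    and "acts_freely V \<theta>"
    and "X \<subseteq> V"
    and "plane_reflection s" and "\<tau> \<in> iso Z2 (point_group s)"
    and "half_turn h" and "\<tau>' \<in> iso Z2 (point_group h)"
  shows "((\<exists>q. spherical_framework V q \<and> Z2_symmetric V \<theta> \<tau> q \<and>
               infinitesimally_rigid V E q \<and> (\<exists>C. great_circle C \<and> q ` X \<subseteq> C))
          \<longleftrightarrow>
          (\<exists>q. spherical_framework V q \<and> Z2_symmetric V \<theta> \<tau>' q \<and>
               infinitesimally_rigid V E q \<and> (\<exists>C. great_circle C \<and> q ` X \<subseteq> C)))
       \<and>
         ((\<exists>q. spherical_framework V q \<and> Z2_symmetric V \<theta> \<tau> q \<and>
               forced_infinitesimally_rigid V E \<theta> \<tau> q \<and> (\<exists>C. great_circle C \<and> q ` X \<subseteq> C))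
          \<longleftrightarrow>
          (\<exists>q. spherical_framework V q \<and> Z2_symmetric V \<theta> \<tau>' q \<and>
               forced_infinitesimally_rigid V E \<theta> \<tau>' q \<and> (\<exists>C. great_circle C \<and> q ` X \<subseteq> C)))"
proof -
  obtain n where n: "norm n = 1" and s: "\<And>x. s x = x - (2 * (n \<bullet> x)) *\<^sub>R n"
    using plane_reflection_formula[OF assms(5)] by blast
  obtain l where l: "norm l = 1" and h: "\<And>x. h x = (2 * (l \<bullet> x)) *\<^sub>R l - x"
    using half_turn_formula[OF assms(7)] by blast
  have "s \<circ> s = id"
    using n by (auto simp: s fun_eq_iff norm_eq_1 inner_diff_right)
  have "s n = - n"
    using n by (simp add: s norm_eq_1 scaleR_2)
  moreover have "n \<noteq> 0"
    using n by auto
  ultimately have "s \<noteq> id"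
    by (rule negating_not_id)
  with \<open>s \<circ> s = id\<close> have \<tau>: "\<tau> 0 = id" "\<tau> 1 = s"
    using iso_Z2_point_group[OF assms(6)] by auto
  have "h \<circ> h = id"
    using l by (auto simp: h fun_eq_iff norm_eq_1 inner_diff_right)
  obtain y where "y \<noteq> 0" "orthogonal l y"
    using orthogonal_to_vector_exists[of l] by (auto simp: orthogonal_commute)
  then have "h y = - y"
    by (simp add: h orthogonal_def)
  then have "h \<noteq> id"
    using \<open>y \<noteq> 0\<close> by (rule negating_not_id)
  with \<open>h \<circ> h = id\<close> have \<tau>': "\<tau>' 0 = id" "\<tau>' 1 = h"
    using iso_Z2_point_group[OF assms(8)] by auto
  \<comment> \<open>\<open>f\<close> carries the mirror normal to the axis, which reduces general
    position to the case where the two coincide.\<close>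
  obtain f where f: "orthogonal_transformation f" "f n = l"
    using orthogonal_transformation_exists[of n l] n l by auto
  define Q where "Q = matrix f"
  have Q: "orthogonal_matrix Q"
    using f(1) by (simp add: Q_def orthogonal_transformation_matrix)
  have "Q *v n = l"
    using f by (simp add: Q_def orthogonal_transformation_def matrix_works)
  \<comment> \<open>Since \<open>l = Q *v n\<close>, orthogonality gives
    \<open>l \<bullet> (Q *v x) = n \<bullet> x\<close>; the two normal forms then differ exactly by
    a sign.\<close>
  then have hQ: "h (Q *v x) = - (Q *v s x)" for x
    using inner_orthogonal_matrix[OF Q, of n x]
    by (simp add: h s matrix_vector_mult_diff_distrib matrix_vector_mult_scaleR)
  have h_scale: "h (c *\<^sub>R x) = c *\<^sub>R h x" for c x
    by (simp add: h scaleR_diff_right)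
  note \<theta> = hom_Z2_graph_Aut[OF assms(2)]
  have free: "\<theta> 1 i \<noteq> i" if "i \<in> V" for i
    using assms(3) that by (auto simp: acts_freely_def carrier_Z2)
  obtain \<sigma> :: "'a \<Rightarrow> real" where \<sigma>: "range \<sigma> \<subseteq> {1, - 1}"
    and alt: "\<And>i. i \<in> V \<Longrightarrow> \<sigma> (\<theta> 1 i) = - \<sigma> i"
    using alternating_sign_exists[of V "\<theta> 1", OF \<theta>(3) free] by blast
  \<comment> \<open>For the nontrivial element, the minus sign of \<open>hQ\<close> is absorbed by
    the sign change of \<open>\<sigma>\<close> between the two vertices of an orbit.\<close>
  have eq: "\<tau>' \<gamma> (\<sigma> i *\<^sub>R (Q *v x)) = \<sigma> (\<theta> \<gamma> i) *\<^sub>R (Q *v \<tau> \<gamma> x)"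
    if "\<gamma> \<in> carrier Z2" "i \<in> V" for \<gamma> i x
    using that by (auto simp: carrier_Z2 \<tau> \<tau>' \<theta> alt h_scale hQ)
  have eq': "\<tau> \<gamma> (\<sigma> i *\<^sub>R (transpose Q *v x)) = \<sigma> (\<theta> \<gamma> i) *\<^sub>R (transpose Q *v \<tau>' \<gamma> x)"
    if "\<gamma> \<in> carrier Z2" "i \<in> V" for \<gamma> i x
    by (rule intertwining_transpose[where f = "\<tau> \<gamma>" and f' = "\<tau>' \<gamma>", OF Q \<sigma> eq[OF that]])
  have Q': "orthogonal_matrix (transpose Q)"
    using Q by simp
  note realisation_signed_image[where \<tau>' = \<tau>' and \<tau> = \<tau>, OF Q \<sigma> eq]
    and realisation_signed_image[where \<tau>' = \<tau> and \<tau> = \<tau>', OF Q' \<sigma> eq']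
  then show ?thesis
    by (intro conjI iffI)
qed

end
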